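(* Every fine ring is $2$-clean.
   Context: Rings are associative with identity, not necessarily commutative. A ring $R$ is called fine if every nonzero element of $R$ is the sum of a unit and a nilpotent element of $R$. A ring is $n$-clean if every element is the sum of an idempotent and $n$ units. *)

theory Defs
  imports "HOL-Algebra.Ring"
begin

definition ring_idempotents :: "('a, 'b) ring_scheme \<Rightarrow> 'a set" where
  "ring_idempotents R = {e \<in> carrier R. e \<otimes>\<^bsub>R\<^esub> e = e}"

definition ring_nilpotents :: "('a, 'b) ring_scheme \<Rightarrow> 'a set" where
  "ring_nilpotents R =
     {x \<in> carrier R. \<exists>k::nat. k > 0 \<and> x [^]\<^bsub>R\<^esub> k = \<zero>\<^bsub>R\<^esub>}"

(* The trivial ring is allowed; it satisfies this condition vacuously. *)
definition fine_ring :: "('a, 'b) ring_scheme \<Rightarrow> bool" where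
  "fine_ring R \<longleftrightarrow> ring R \<and>
     (\<forall>a \<in> carrier R - {\<zero>\<^bsub>R\<^esub>}.
        \<exists>u \<in> Units R. \<exists>x \<in> ring_nilpotents R. a = u \<oplus>\<^bsub>R\<^esub> x)"

(* The n units need not be distinct, so they are given as a family u 0, ..., u (n - 1). *)
definition n_clean_ring :: "nat \<Rightarrow> ('a, 'b) ring_scheme \<Rightarrow> bool" where
  "n_clean_ring n R \<longleftrightarrow> ring R \<and>
     (\<forall>a \<in> carrier R.
        \<exists>e \<in> ring_idempotents R. \<exists>u \<in> {..<n} \<rightarrow> Units R.
          a = e \<oplus>\<^bsub>R\<^esub> (\<Oplus>\<^bsub>R\<^esub>i\<in>{..<n}. u i))"

end

theory Submission
  imports Defs
begin

text \<open>Fineness is applied to \<one> \<ominus> a rather than to a. If a \<noteq> \<one>, write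
  \<one> \<ominus> a = u \<oplus> x with u a unit and x nilpotent; then a = \<ominus> u \<oplus>
  (\<one> \<ominus> x) is already a sum of two units, with idempotent \<zero>, because \<one> minus
  a nilpotent is invertible (\<open>one_minus_nilpotent_Unit\<close>) and units are closed under
  negation (\<open>minus_Unit\<close>). The remaining element \<one> is \<one> \<oplus> (\<one>
  \<oplus> \<ominus> \<one>), with idempotent \<one>.\<close>

text \<open>The geometric series \<one> + x + x^2 + ... stops because x is nilpotent, and its sum is
  a two-sided inverse of \<one> \<ominus> x.\<close>

lemma (in ring) one_minus_nilpotent_Unit:
  assumes "x \<in> ring_nilpotents R"
  shows "\<one> \<ominus> x \<in> Units R"
proof -
  from assms obtain k :: nat where x: "x \<in> carrier R" and k: "x [^] k = \<zero>"
    by (auto simp: ring_nilpotents_def)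
  \<comment> \<open>The witness built by the induction is the partial sum of the powers of x below
    n, starting from the empty sum \<zero>. Both products are tracked because the ring need not be
    commutative; at n = k the power of x vanishes.\<close>
  have "\<exists>y\<in>carrier R. (\<one> \<ominus> x) \<otimes> y = \<one> \<ominus> x [^] n \<and> y \<otimes> (\<one> \<ominus> x) = \<one> \<ominus> x [^] n" for n :: nat
  proof (induction n)
    case 0
    show ?case using x by (intro bexI[of _ \<zero>]) (auto simp: minus_eq r_neg)
  next
    case (Suc n)
    then obtain y where y: "y \<in> carrier R" "(\<one> \<ominus> x) \<otimes> y = \<one> \<ominus> x [^] n"
      "y \<otimes> (\<one> \<ominus> x) = \<one> \<ominus> x [^] n"
      by blast
    define p where "p = x [^] n"
    have p: "p \<in> carrier R" "x \<otimes> p = x [^] Suc n" "p \<otimes> x = x [^] Suc n"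
      \<comment> \<open>Powers grow by a factor on the right; \<open>nat_pow_Suc2\<close> moves it
        to the left, so x commutes with its own power p.\<close>
      using x nat_pow_Suc2[of x n] by (auto simp: p_def)
    have "(\<one> \<ominus> x) \<otimes> (y \<oplus> p) = (\<one> \<ominus> x) \<otimes> y \<oplus> (p \<ominus> x \<otimes> p)"
      using x y(1) p(1) by algebra
    also have "\<dots> = (\<one> \<ominus> p) \<oplus> (p \<ominus> x [^] Suc n)"
      using y(2) p(2) by (simp add: p_def)
    also have telescope: "\<dots> = \<one> \<ominus> x [^] Suc n"
      using x p(1) nat_pow_closed[of x "Suc n"] by algebra
    finally have l: "(\<one> \<ominus> x) \<otimes> (y \<oplus> p) = \<one> \<ominus> x [^] Suc n" .
    have "(y \<oplus> p) \<otimes> (\<one> \<ominus> x) = y \<otimes> (\<one> \<ominus> x) \<oplus> (p \<ominus> p \<otimes> x)"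
      using x y(1) p(1) by (simp add: minus_eq l_distr r_distr r_minus minus_add a_ac)
    also have "\<dots> = (\<one> \<ominus> p) \<oplus> (p \<ominus> x [^] Suc n)"
      using y(3) p(3) by (simp add: p_def)
    finally have "(y \<oplus> p) \<otimes> (\<one> \<ominus> x) = \<one> \<ominus> x [^] Suc n"
      using telescope by simp
    with l y(1) p(1) show ?case by blast
  qed
  from this[of k] obtain y where "y \<in> carrier R" "(\<one> \<ominus> x) \<otimes> y = \<one>" "y \<otimes> (\<one> \<ominus> x) = \<one>"
    by (auto simp: k minus_eq)
  with x show ?thesis by (auto simp: Units_def)
qed

lemma (in ring) minus_Unit:
  assumes "u \<in> Units R"
  shows "\<ominus> u \<in> Units R"
proof -
  have "(\<ominus> (inv u)) \<otimes> (\<ominus> u) = \<one>" "(\<ominus> u) \<otimes> (\<ominus> (inv u)) = \<one>"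
    using assms by (simp_all add: l_minus r_minus Units_closed)
  with assms show ?thesis
    using Units_inv_closed[of u] Units_closed[of u] a_inv_closed
    unfolding Units_def by blast
qed

text \<open>Replaces the indexed family of units in the definition by two named units, so that the
  main argument need not handle finite sums.\<close>

lemma (in ring) n_clean_ring_2I:
  assumes "\<And>a. a \<in> carrier R \<Longrightarrow>
    \<exists>e\<in>ring_idempotents R. \<exists>u\<in>Units R. \<exists>v\<in>Units R. a = e \<oplus> (u \<oplus> v)"
  shows "n_clean_ring 2 R"
  unfolding n_clean_ring_def
proof (intro conjI ballI)
  fix a assume "a \<in> carrier R"
  with assms obtain e u v where euv: "e \<in> ring_idempotents R" "u \<in> Units R" "v \<in> Units R"
    "a = e \<oplus> (u \<oplus> v)"
    by blast
  define f where "f i = (if i = 0 then u else v)" for i :: nat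
  have two: "{..<2} = {0, Suc 0}" by auto
  have "(\<Oplus>i\<in>{..<2}. f i) = u \<oplus> v"
    using euv by (simp add: two f_def finsum_insert[of "{Suc 0}" 0] Units_closed Pi_def)
  moreover have "f \<in> {..<2} \<rightarrow> Units R"
    using euv by (auto simp: f_def)
  ultimately show "\<exists>e\<in>ring_idempotents R. \<exists>u\<in>{..<2::nat} \<rightarrow> Units R. a = e \<oplus> (\<Oplus>i\<in>{..<2}. u i)"
    using euv by metis
qed (rule ring_axioms)

theorem corollary2p20:
  fixes R :: "('a, 'b) ring_scheme" (structure)
  assumes "fine_ring R"
  shows "n_clean_ring 2 R"
proof -
  interpret ring R using assms by (simp add: fine_ring_def)
  show ?thesis
  proof (rule n_clean_ring_2I)
    fix a assume a: "a \<in> carrier R"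
    show "\<exists>e\<in>ring_idempotents R. \<exists>u\<in>Units R. \<exists>v\<in>Units R. a = e \<oplus> (u \<oplus> v)"
    proof (cases "a = \<one>")
      \<comment> \<open>Here \<one> \<ominus> a is \<zero>, about which fineness says nothing. The
        trivial ring falls under this case too.\<close>
      case True
      have "\<one> \<in> ring_idempotents R" by (simp add: ring_idempotents_def)
      moreover have "\<one> = \<one> \<oplus> (\<one> \<oplus> \<ominus> \<one>)" by (simp add: r_neg)
      ultimately show ?thesis
        using True Units_one_closed minus_Unit by blast
    next
      case False
      have double_minus: "a = \<one> \<ominus> (\<one> \<ominus> a)" using a by algebra
      have "\<one> \<ominus> a \<noteq> \<zero>"
        using double_minus False by (auto simp: minus_eq)
      then have "\<one> \<ominus> a \<in> carrier R - {\<zero>}"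
        using a by simp
      then obtain u x where u: "u \<in> Units R" and x: "x \<in> ring_nilpotents R"
        and eq: "\<one> \<ominus> a = u \<oplus> x"
        using assms unfolding fine_ring_def by blast
      have carr: "u \<in> carrier R" "x \<in> carrier R"
        using u x by (auto simp: ring_nilpotents_def)
      \<comment> \<open>Subtracting from \<one> negates the unit and turns the nilpotent x into the
        second unit \<one> \<ominus> x.\<close>
      have "\<one> \<ominus> (\<one> \<ominus> a) = \<zero> \<oplus> (\<ominus> u \<oplus> (\<one> \<ominus> x))"
        unfolding eq using carr by algebra
      with double_minus have "a = \<zero> \<oplus> (\<ominus> u \<oplus> (\<one> \<ominus> x))" by simp
      moreover have "\<zero> \<in> ring_idempotents R" by (simp add: ring_idempotents_def)
      ultimately show ?thesis
        using minus_Unit[OF u] one_minus_nilpotent_Unit[OF x] by blast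
    qed
  qed
qed

end
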